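(* Let $q>0$ be a constant, and let $M,Q,R$ be real random variables such that $|Q|\le q$ and $|M|\le 1$ almost surely, and $$R\stackrel{d}{=}MR+Q,$$ where on the right-hand side the pair $(M,Q)$ is independent of $R$. For $0<\delta<1$ put $p_\delta:=P(1-\delta\le |M|\le 1)$. Then, for all sufficiently large $x$, $$P(|R|>x)\le \exp\left(\frac{1}{4q}\,x\,\ln p_{2q/x}\right).$$ Thus, if $Q\equiv q$ and $0\le M\le 1$ almost surely, then for all sufficiently large $x$, $$\exp\left(\frac{2\ln 2}{q}\,x\,\ln p_{q/(2x)}\right)\le P(R>x)\le \exp\left(\frac{1}{4q}\,x\,\ln p_{2q/x}\right).$$
   Context: Here $\stackrel{d}{=}$ denotes equality in distribution. A random variable $R$ satisfying $R\stackrel{d}{=}MR+Q$ with $(M,Q)$ independent of $R$ on the right-hand side is called a perpetuity; $M$ and $Q$ need not be independent of each other. "Sufficiently large $x$" means that there is $x_0$ (which may depend on the distribution of $(M,Q)$ and on $q$) such that the inequality holds for all $x\ge x_0$; in particular $x$ is large enough that $2q/x$ and $q/(2x)$ lie in $(0,1)$. If $p_\delta=0$, then $\ln p_\delta$ is read as $-\infty$ and the corresponding exponential as $0$. *)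

theory Defs
  imports "HOL-Probability.Probability"
begin

definition eq_distr :: "'a measure \<Rightarrow> ('a \<Rightarrow> real) \<Rightarrow> ('a \<Rightarrow> real) \<Rightarrow> bool" where
  "eq_distr P X Y \<longleftrightarrow> distr P borel X = distr P borel Y"

text \<open>Independence of two random variables with possibly different value types, stated through
  the generated sigma-algebras; the library's \<open>indep_var\<close> requires both variables to have the same
  value type.\<close>

definition indep_rv ::
  "'a measure \<Rightarrow> ('a \<Rightarrow> 'b::topological_space) \<Rightarrow> ('a \<Rightarrow> 'c::topological_space) \<Rightarrow> bool" where
  "indep_rv P X Y \<longleftrightarrow>
     X \<in> borel_measurable P \<and> Y \<in> borel_measurable P \<and>
     prob_space.indep_set P
       {X -` A \<inter> space P |A. A \<in> sets borel} {Y -` B \<inter> space P |B. B \<in> sets borel}"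

text \<open>The variable \<open>R\<close> itself plays the role of the copy that is independent of the pair
  \<open>(M, Q)\<close>; the distributional equation and all tail probabilities involve \<open>R\<close> only through
  its law.  No independence between \<open>M\<close> and \<open>Q\<close> is assumed.\<close>

definition perpetuity ::
  "'a measure \<Rightarrow> ('a \<Rightarrow> real) \<Rightarrow> ('a \<Rightarrow> real) \<Rightarrow> ('a \<Rightarrow> real) \<Rightarrow> bool" where
  "perpetuity P M Q R \<longleftrightarrow>
     prob_space P \<and>
     M \<in> borel_measurable P \<and> Q \<in> borel_measurable P \<and> R \<in> borel_measurable P \<and>
     indep_rv P (\<lambda>\<omega>. (M \<omega>, Q \<omega>)) R \<and>
     eq_distr P R (\<lambda>\<omega>. M \<omega> * R \<omega> + Q \<omega>)"

definition p_near_one :: "'a measure \<Rightarrow> ('a \<Rightarrow> real) \<Rightarrow> real \<Rightarrow> real" where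
  "p_near_one P M \<delta> = \<P>(\<omega> in P. 1 - \<delta> \<le> \<bar>M \<omega>\<bar> \<and> \<bar>M \<omega>\<bar> \<le> 1)"

text \<open>\<open>exp (c ln p)\<close> for \<open>c > 0\<close> and \<open>p \<ge> 0\<close>, with \<open>ln 0 = -\<infinity>\<close> and \<open>exp (-\<infinity>) = 0\<close>.  The case
  distinction is needed because the library's real logarithm has \<open>ln 0 = 0\<close>.\<close>

definition exp_mult_ln :: "real \<Rightarrow> real \<Rightarrow> real" where
  "exp_mult_ln c p = (if p = 0 then 0 else exp (c * ln p))"

end

theory Submission
  imports Defs "HOL-Real_Asymp.Real_Asymp"
begin

text \<open>
  \<^bold>\<open>Upper bound.\<close>  Since \<open>|MR + Q| \<le> |M||R| + q\<close>, the law \<open>V\<close> of \<open>|R|\<close> is stochastically below its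
  own image under the random affine map \<open>r \<mapsto> |M| r + q\<close>.  Iterating, \<open>V\<close> lies below the law of
  \<open>Z\<^sub>n + |M\<^sub>1 \<cdots> M\<^sub>n| |R|\<close>, where \<open>Z\<^sub>n\<close> is the orbit of \<open>0\<close> after \<open>n\<close> independent steps.  Unless \<open>|M| = 1\<close>
  almost surely (then the claimed bound is \<open>1\<close>), \<open>E|M| < 1\<close> and the contribution of the start
  dies out (lemma \<open>dominated_le_orbit\<close>), so tails of \<open>|R|\<close> are controlled by exponential moments
  of \<open>Z\<^sub>n\<close>.

  These moments are compared with those of a constant \<open>B\<close>: if
  \<open>E exp (s (q + |M| B - B)) \<le> 1\<close>, then \<open>E exp (t Z\<^sub>n) \<le> exp (t B)\<close> for all \<open>n\<close> and \<open>0 \<le> t \<le> s\<close>,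
  whence \<open>P(|R| > x) \<le> exp (- s (x - B))\<close> (theorem \<open>dominated_tail_le\<close>).  Splitting according to
  whether \<open>|M| \<ge> 1 - \<delta>\<close>, the condition on \<open>(s, B)\<close> follows from
  \<open>p\<^sub>\<delta> exp (s q) + (1 - p\<^sub>\<delta>) exp (s (q - \<delta> B)) \<le> 1\<close>.  Let \<open>p\<^sub>0 = P(|M| = 1)\<close> and \<open>\<delta> = 2 q / x\<close>.
    \<^item> If \<open>p\<^sub>0 = 0\<close>, then \<open>p\<^sub>\<delta> \<le> 1/16\<close> for large \<open>x\<close>, and \<open>exp (s q) = p\<^sub>\<delta> powr (-3/4)\<close>, \<open>B = 2 x / 3\<close>
      gives exactly the exponent claimed.  If even \<open>p\<^sub>\<delta> = 0\<close>, then \<open>B = x / 2\<close> admits every \<open>s\<close>,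
      and \<open>s \<rightarrow> \<infinity>\<close> shows that the tail vanishes.
    \<^item> If \<open>0 < p\<^sub>0 < 1\<close>, then \<open>R\<close> has exponential moments of every order below \<open>ln (1 / p\<^sub>0) / q\<close>.
      Half of this order, with some fixed \<open>B\<close>, already beats the claimed rate
      \<open>ln (1 / p\<^sub>\<delta>) / (4 q) \<le> ln (1 / p\<^sub>0) / (4 q)\<close> once \<open>x \<ge> 2 B\<close>.

  \<^bold>\<open>Lower bound.\<close>  If \<open>Q = q\<close> and \<open>0 \<le> M \<le> 1\<close>, then \<open>R \<ge> q\<close> almost surely, and \<open>n\<close> consecutive factors
  in \<open>[1 - \<delta>, 1]\<close> force \<open>R \<ge> q (1 + (1 - \<delta>) + \<cdots> + (1 - \<delta>)\<^sup>n)\<close>.  For \<open>\<delta> = q / (2 x)\<close> and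
  \<open>n = \<lfloor>ln 2 / \<delta>\<rfloor>\<close> this exceeds \<open>x\<close>, and the event has probability at least \<open>p\<^sub>\<delta>\<^sup>n\<close>.
\<close>

section \<open>The majorising affine recursion\<close>

text \<open>\<open>N\<close> stands for the law of \<open>|M|\<close>.\<close>

locale contraction_law = prob_space N for N :: "real measure" +
  fixes q :: real
  assumes sets_N [measurable_cong]: "sets N = sets borel"
    and unit_interval: "AE m in N. 0 \<le> m \<and> m \<le> 1"
    and q_pos: "q > 0"
begin

definition step :: "real measure \<Rightarrow> real measure" where
  "step V = distr (N \<Otimes>\<^sub>M V) borel (\<lambda>(m, r). m * r + q)"

definition orbit :: "nat \<Rightarrow> real measure" where
  "orbit n = (step ^^ n) (return borel 0)"

text \<open>The last condition says that \<open>V\<close> is below \<open>step V\<close> in the usual stochastic order.\<close>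

definition dominated :: "real measure \<Rightarrow> bool" where
  "dominated V \<longleftrightarrow> prob_space V \<and> sets V = sets borel \<and> (AE r in V. 0 \<le> r) \<and>
     (\<forall>f. mono f \<and> (\<forall>r. 0 \<le> f r \<and> f r \<le> (1::real)) \<longrightarrow>
        (\<integral>r. f r \<partial>V) \<le> (\<integral>r. f r \<partial>step V))"

lemma space_N [simp]: "space N = UNIV"
  using sets_eq_imp_space_eq[OF sets_N] by simp

lemma sets_step [simp, measurable_cong]: "sets (step V) = sets borel"
  by (simp add: step_def)

lemma prob_space_step:
  assumes "prob_space V" and [measurable_cong]: "sets V = sets borel"
  shows "prob_space (step V)"
proof -
  interpret V: prob_space V by fact
  interpret pair_prob_space N V ..
  show ?thesis unfolding step_def by (rule prob_space_distr) measurable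
qed

lemma sets_orbit [simp, measurable_cong]: "sets (orbit n) = sets borel"
  by (cases n) (auto simp: orbit_def)

lemma prob_space_orbit: "prob_space (orbit n)"
proof (induction n)
  case 0
  show ?case by (simp add: orbit_def prob_space_return)
next
  case (Suc n)
  then show ?case using prob_space_step[of "orbit n"] sets_orbit[of n] by (simp add: orbit_def)
qed

lemma nn_integral_step:
  assumes "prob_space V" and [measurable_cong]: "sets V = sets borel"
    and [measurable]: "f \<in> borel_measurable borel"
  shows "(\<integral>\<^sup>+r. f r \<partial>step V) = (\<integral>\<^sup>+m. \<integral>\<^sup>+r. f (m * r + q) \<partial>V \<partial>N)"
proof -
  interpret V: prob_space V by fact
  have "(\<integral>\<^sup>+r. f r \<partial>step V) = (\<integral>\<^sup>+z. f (case z of (m, r) \<Rightarrow> m * r + q) \<partial>(N \<Otimes>\<^sub>M V))"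
    unfolding step_def by (rule nn_integral_distr) measurable
  also have "\<dots> = (\<integral>\<^sup>+m. \<integral>\<^sup>+r. f (m * r + q) \<partial>V \<partial>N)"
    by (subst V.nn_integral_fst[symmetric]) auto
  finally show ?thesis .
qed

lemma integral_step:
  fixes f :: "real \<Rightarrow> real"
  assumes "prob_space V" and [measurable_cong]: "sets V = sets borel"
    and [measurable]: "f \<in> borel_measurable borel" and bounded: "\<And>r. 0 \<le> f r \<and> f r \<le> 1"
  shows "(\<integral>r. f r \<partial>step V) = (\<integral>r. \<integral>m. f (m * r + q) \<partial>N \<partial>V)"
proof -
  interpret V: prob_space V by fact
  interpret pair_prob_space N V ..
  have "(\<integral>r. f r \<partial>step V) = (\<integral>z. f (case z of (m, r) \<Rightarrow> m * r + q) \<partial>(N \<Otimes>\<^sub>M V))"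
    unfolding step_def by (rule integral_distr) measurable
  also have "\<dots> = (\<integral>(m, r). f (m * r + q) \<partial>(N \<Otimes>\<^sub>M V))"
    by (rule Bochner_Integration.integral_cong) auto
  also have "\<dots> = (\<integral>r. \<integral>m. f (m * r + q) \<partial>N \<partial>V)"
    by (rule integral_snd[symmetric], rule integrable_const_bound[where B = 1])
       (auto simp: case_prod_beta bounded)
  finally show ?thesis .
qed

text \<open>The hypothesis says that \<open>m B + q\<close> has no larger exponential moment of order \<open>s\<close> than the
  constant \<open>B\<close>.  As \<open>t \<mapsto> E exp (t (q + m B - B))\<close> is convex with value \<open>1\<close> at \<open>t = 0\<close>, the same holds
  for all orders \<open>t \<le> s\<close>.  The induction needs all of them at once: a step replaces the order \<open>t\<close> by
  the random order \<open>t m\<close>.\<close>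

lemma exp_orbit_le:
  assumes drift: "(\<integral>m. exp (s * (q + m * B - B)) \<partial>N) \<le> 1"
    and "0 \<le> t" "t \<le> s" "0 \<le> B"
  shows "(\<integral>\<^sup>+z. ennreal (exp (t * z)) \<partial>orbit n) \<le> ennreal (exp (t * B))"
  using \<open>0 \<le> t\<close> \<open>t \<le> s\<close>
proof (induction n arbitrary: t)
  case 0
  then show ?case using \<open>0 \<le> B\<close> by (simp add: orbit_def nn_integral_return)
next
  case (Suc n)
  have int: "integrable N (\<lambda>m. exp (s * (q + m * B - B)))"
  proof (rule integrable_const_bound[where B = "exp (s * q)"])
    show "AE m in N. norm (exp (s * (q + m * B - B))) \<le> exp (s * q)"
      using unit_interval
    proof eventually_elim
      case (elim m)
      then have "m * B \<le> B" using \<open>0 \<le> B\<close> by (simp add: mult_left_le_one_le)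
      then show ?case using Suc.prems by (auto intro!: mult_left_mono)
    qed
  qed measurable
  have convex: "(\<integral>m. exp (t * (q + m * B - B)) \<partial>N) \<le> 1"
    and int_t: "integrable N (\<lambda>m. exp (t * (q + m * B - B)))"
  proof -
    define \<theta> where "\<theta> = t / s"
    have \<theta>: "0 \<le> \<theta>" "\<theta> \<le> 1" "t = \<theta> * s" using Suc.prems by (auto simp: \<theta>_def divide_simps)
    have pointwise: "exp (t * y) \<le> (1 - \<theta>) + \<theta> * exp (s * y)" for y
      using convex_onD[OF exp_convex, of \<theta> 0 "s * y"] \<theta> by (simp add: mult.assoc)
    show int_t: "integrable N (\<lambda>m. exp (t * (q + m * B - B)))"
      by (rule Bochner_Integration.integrable_bound[where f = "\<lambda>m. (1 - \<theta>) + \<theta> * exp (s * (q + m * B - B))"])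
         (use int pointwise \<theta> in \<open>auto intro!: AE_I2 order_trans[OF pointwise] abs_ge_self\<close>)
    have "(\<integral>m. exp (t * (q + m * B - B)) \<partial>N) \<le> (\<integral>m. (1 - \<theta>) + \<theta> * exp (s * (q + m * B - B)) \<partial>N)"
      by (intro integral_mono int_t pointwise) (use int in auto)
    also have "\<dots> = (1 - \<theta>) + \<theta> * (\<integral>m. exp (s * (q + m * B - B)) \<partial>N)"
      using int prob_space by simp
    also have "\<dots> \<le> (1 - \<theta>) + \<theta> * 1"
      using drift \<theta> by (intro add_left_mono mult_left_mono) auto
    finally show "(\<integral>m. exp (t * (q + m * B - B)) \<partial>N) \<le> 1" by simp
  qed
  have "(\<integral>\<^sup>+z. ennreal (exp (t * z)) \<partial>orbit (Suc n))
      = (\<integral>\<^sup>+m. \<integral>\<^sup>+z. ennreal (exp (t * (m * z + q))) \<partial>orbit n \<partial>N)"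
    using nn_integral_step[OF prob_space_orbit sets_orbit, of "\<lambda>z. ennreal (exp (t * z))" n]
    by (simp add: orbit_def)
  also have "\<dots> = (\<integral>\<^sup>+m. ennreal (exp (t * q)) * (\<integral>\<^sup>+z. ennreal (exp (t * m * z)) \<partial>orbit n) \<partial>N)"
    by (subst nn_integral_cmult[symmetric])
       (auto intro!: nn_integral_cong simp: ennreal_mult[symmetric] exp_add[symmetric] algebra_simps)
  also have "\<dots> \<le> (\<integral>\<^sup>+m. ennreal (exp (t * q)) * ennreal (exp (t * m * B)) \<partial>N)"
  proof (rule nn_integral_mono_AE)
    show "AE m in N. ennreal (exp (t * q)) * (\<integral>\<^sup>+z. ennreal (exp (t * m * z)) \<partial>orbit n)
        \<le> ennreal (exp (t * q)) * ennreal (exp (t * m * B))"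
      using unit_interval
    proof eventually_elim
      case (elim m)
      have "t * m \<le> s" using Suc.prems elim mult_left_le[of m t] by linarith
      then show ?case using Suc.IH[of "t * m"] Suc.prems elim by (intro mult_left_mono) auto
    qed
  qed
  also have "\<dots> = (\<integral>\<^sup>+m. ennreal (exp (t * B)) * ennreal (exp (t * (q + m * B - B))) \<partial>N)"
    by (auto intro!: nn_integral_cong simp: ennreal_mult[symmetric] exp_add[symmetric] algebra_simps)
  also have "\<dots> = ennreal (exp (t * B)) * ennreal (\<integral>m. exp (t * (q + m * B - B)) \<partial>N)"
    using int_t by (subst nn_integral_cmult) (auto simp: nn_integral_eq_integral)
  also have "\<dots> \<le> ennreal (exp (t * B)) * 1"
    using convex by (intro mult_left_mono) (auto simp: ennreal_le_1)
  finally show ?case by simp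
qed

section \<open>Forgetting the starting point\<close>

lemma mean_nonneg: "0 \<le> (\<integral>m. m \<partial>N)"
  using unit_interval by (intro integral_nonneg_AE) auto

lemma integrable_id: "integrable N (\<lambda>m. m)"
  using unit_interval by (intro integrable_const_bound[where B = 1]) auto

lemma mean_less_one:
  assumes "measure N {1} < 1"
  shows "(\<integral>m. m \<partial>N) < 1"
proof (rule ccontr)
  assume "\<not> ?thesis"
  then have "(\<integral>m. 1 - m \<partial>N) \<le> 0"
    using integrable_id prob_space by simp
  moreover have nonneg: "AE m in N. 0 \<le> 1 - m" using unit_interval by auto
  ultimately have "(\<integral>m. 1 - m \<partial>N) = 0"
    using integral_nonneg_AE[OF nonneg] by linarith
  then have "AE m in N. 1 - m = 0"
    using integral_nonneg_eq_0_iff_AE[OF _ nonneg] integrable_id by simp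
  then have "AE m in N. m \<in> {1}" by auto
  then have "measure N {1} = 1" using prob_eq_1[of "{1}"] by simp
  with assms show False by simp
qed

text \<open>Integrating \<open>f (m r + q)\<close> over \<open>m\<close> preserves monotonicity and the range \<open>[0, 1]\<close> and multiplies
  the Lipschitz constant by the mean of \<open>N\<close>.  The error term is the cost of starting at \<open>0\<close>
  instead of at a point distributed according to \<open>V\<close>; truncated at \<open>1\<close>, it is integrable
  even if \<open>V\<close> has no finite moment, and it still tends to \<open>0\<close> when the mean of \<open>N\<close> is below \<open>1\<close>.\<close>

lemma dominated_le_orbit:
  fixes f :: "real \<Rightarrow> real"
  assumes V: "dominated V"
    and "mono f" and "\<And>r. 0 \<le> f r \<and> f r \<le> 1"
    and "\<And>a b. \<bar>f a - f b\<bar> \<le> L * \<bar>a - b\<bar>" and "0 \<le> L"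
  shows "(\<integral>r. f r \<partial>V) \<le> (\<integral>r. f r \<partial>orbit n) + (\<integral>r. min 1 (L * (\<integral>m. m \<partial>N) ^ n * r) \<partial>V)"
  using assms(2-)
proof (induction n arbitrary: f L)
  case 0
  interpret V: prob_space V using V by (simp add: dominated_def)
  have [measurable_cong]: "sets V = sets borel" using V by (simp add: dominated_def)
  have nonneg: "AE r in V. 0 \<le> r" using V by (simp add: dominated_def)
  have [measurable]: "f \<in> borel_measurable borel" using "0.prems"(1) by (rule borel_measurable_mono)
  have int: "integrable V (\<lambda>r. min 1 (L * r))"
    using nonneg \<open>0 \<le> L\<close> by (intro V.integrable_const_bound[where B = 1]) auto
  have "(\<integral>r. f r \<partial>V) \<le> (\<integral>r. f 0 + min 1 (L * r) \<partial>V)"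
  proof (rule integral_mono_AE)
    show "integrable V f"
      using "0.prems"(2) by (intro V.integrable_const_bound[where B = 1]) auto
    show "AE r in V. f r \<le> f 0 + min 1 (L * r)"
      using nonneg
    proof eventually_elim
      case (elim r)
      then show ?case using "0.prems"(2)[of r] "0.prems"(2)[of 0] "0.prems"(3)[of r 0] by auto
    qed
  qed (use int in auto)
  also have "\<dots> = f 0 + (\<integral>r. min 1 (L * r) \<partial>V)"
    using int V.prob_space by simp
  finally show ?case by (simp add: orbit_def integral_return)
next
  case (Suc n)
  interpret V: prob_space V using V by (simp add: dominated_def)
  have sets_V [measurable_cong]: "sets V = sets borel" using V by (simp add: dominated_def)
  have [measurable]: "f \<in> borel_measurable borel" using Suc.prems(1) by (rule borel_measurable_mono)
  define g where "g r = (\<integral>m. f (m * r + q) \<partial>N)" for r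
  have int_f: "integrable N (\<lambda>m. f (m * r + q))" for r
    using Suc.prems(2) by (intro integrable_const_bound[where B = 1]) auto
  have g_mono: "mono g"
  proof
    fix a b :: real
    assume "a \<le> b"
    show "g a \<le> g b" unfolding g_def
      by (rule integral_mono_AE[OF int_f int_f])
         (use unit_interval \<open>a \<le> b\<close> in \<open>auto intro!: monoD[OF \<open>mono f\<close>] mult_left_mono\<close>)
  qed
  have g_bounds: "0 \<le> g r \<and> g r \<le> 1" for r
    using integral_mono[OF int_f integrable_const[of 1], of r] Suc.prems(2) prob_space
    by (auto simp: g_def)
  have g_lipschitz: "\<bar>g a - g b\<bar> \<le> L * (\<integral>m. m \<partial>N) * \<bar>a - b\<bar>" for a b
  proof -
    have "\<bar>g a - g b\<bar> = \<bar>\<integral>m. f (m * a + q) - f (m * b + q) \<partial>N\<bar>"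
      by (simp add: g_def int_f)
    also have "\<dots> \<le> (\<integral>m. \<bar>f (m * a + q) - f (m * b + q)\<bar> \<partial>N)"
      by (rule integral_abs_bound)
    also have "\<dots> \<le> (\<integral>m. L * \<bar>a - b\<bar> * m \<partial>N)"
    proof (rule integral_mono_AE)
      show "AE m in N. \<bar>f (m * a + q) - f (m * b + q)\<bar> \<le> L * \<bar>a - b\<bar> * m"
        using unit_interval
      proof eventually_elim
        case (elim m)
        have "m * a + q - (m * b + q) = m * (a - b)" by (simp add: algebra_simps)
        then show ?case
          using Suc.prems(3)[of "m * a + q" "m * b + q"] elim by (simp add: abs_mult mult_ac)
      qed
    qed (use int_f integrable_id in auto)
    finally show ?thesis by (simp add: mult_ac)
  qed
  have "(\<integral>r. f r \<partial>V) \<le> (\<integral>r. f r \<partial>step V)"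
    using V Suc.prems(1,2) by (simp add: dominated_def)
  also have "\<dots> = (\<integral>r. g r \<partial>V)"
    unfolding g_def by (rule integral_step) (use sets_V Suc.prems(2) in \<open>auto intro: V.prob_space_axioms\<close>)
  also have "\<dots> \<le> (\<integral>r. g r \<partial>orbit n)
      + (\<integral>r. min 1 (L * (\<integral>m. m \<partial>N) * (\<integral>m. m \<partial>N) ^ n * r) \<partial>V)"
    by (rule Suc.IH[OF g_mono g_bounds g_lipschitz])
       (use \<open>0 \<le> L\<close> mean_nonneg in auto)
  also have "(\<integral>r. g r \<partial>orbit n) = (\<integral>r. f r \<partial>orbit (Suc n))"
    using integral_step[OF prob_space_orbit sets_orbit, of f n] Suc.prems(2)
    by (simp add: g_def orbit_def)
  finally show ?case by (simp add: mult_ac)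
qed

section \<open>Exponential tail bounds\<close>

text \<open>Markov's inequality for \<open>exp (s r)\<close>, applied to the orbit of \<open>0\<close>.  Capping the exponential at
  \<open>1\<close> beyond \<open>x\<close> keeps it above the indicator of \<open>{x<..}\<close> and makes it bounded and Lipschitz, so that
  \<open>V\<close> can be replaced by the orbit in the limit.\<close>

theorem dominated_tail_le:
  assumes V: "dominated V" and "measure N {1} < 1"
    and drift: "(\<integral>m. exp (s * (q + m * B - B)) \<partial>N) \<le> 1"
    and "0 \<le> s" "0 \<le> B"
  shows "measure V {x<..} \<le> exp (- (s * (x - B)))"
proof -
  interpret V: prob_space V using V by (simp add: dominated_def)
  have [measurable_cong]: "sets V = sets borel" using V by (simp add: dominated_def)
  have nonneg: "AE r in V. 0 \<le> r" using V by (simp add: dominated_def)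
  define c where "c = (\<integral>m. m \<partial>N)"
  have c: "0 \<le> c" "c < 1" using mean_nonneg mean_less_one assms(2) by (auto simp: c_def)
  define f where "f r = exp (min 0 (s * (r - x)))" for r
  have f_meas [measurable]: "f \<in> borel_measurable borel" unfolding f_def by measurable
  have f_mono: "mono f"
    using \<open>0 \<le> s\<close> by (auto simp: mono_def f_def min_def mult_left_mono intro: mult_nonneg_nonpos)
       (smt (verit) mult_left_mono)+
  have f_bounds: "0 \<le> f r \<and> f r \<le> 1" for r by (simp add: f_def)
  have exp_lipschitz: "\<bar>exp u - exp v\<bar> \<le> \<bar>u - v\<bar>" if "u \<le> 0" "v \<le> 0" for u v :: real
  proof -
    have *: "exp b - exp a \<le> b - a" if "a \<le> b" "b \<le> 0" for a b :: real
    proof -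
      have "exp b - exp a = exp b * (1 - exp (a - b))" by (simp add: right_diff_distrib exp_add[symmetric])
      also have "\<dots> \<le> 1 * (b - a)"
      proof (rule mult_mono)
        show "1 - exp (a - b) \<le> b - a" using exp_ge_add_one_self[of "a - b"] by linarith
      qed (use that in auto)
      finally show ?thesis by simp
    qed
    show ?thesis using *[of u v] *[of v u] that by (cases "u \<le> v") auto
  qed
  have f_lipschitz: "\<bar>f a - f b\<bar> \<le> s * \<bar>a - b\<bar>" for a b
  proof -
    have "\<bar>f a - f b\<bar> \<le> \<bar>min 0 (s * (a - x)) - min 0 (s * (b - x))\<bar>"
      unfolding f_def by (rule exp_lipschitz) auto
    also have "\<dots> \<le> \<bar>s * (a - x) - s * (b - x)\<bar>" by (auto simp: min_def)
    also have "s * (a - x) - s * (b - x) = s * (a - b)" by (simp add: algebra_simps)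
    finally show ?thesis using \<open>0 \<le> s\<close> by (simp add: abs_mult)
  qed
  have orbit_le: "(\<integral>r. f r \<partial>orbit n) \<le> exp (- (s * (x - B)))" for n
  proof -
    interpret O: prob_space "orbit n" by (rule prob_space_orbit)
    have "integrable (orbit n) f"
      using f_bounds by (intro O.integrable_const_bound[where B = 1]) auto
    then have "ennreal (\<integral>r. f r \<partial>orbit n) = (\<integral>\<^sup>+r. ennreal (f r) \<partial>orbit n)"
      using f_bounds by (simp add: nn_integral_eq_integral)
    also have "\<dots> \<le> (\<integral>\<^sup>+r. ennreal (exp (- (s * x))) * ennreal (exp (s * r)) \<partial>orbit n)"
      by (intro nn_integral_mono)
         (auto simp: f_def ennreal_mult[symmetric] exp_add[symmetric] algebra_simps)
    also have "\<dots> = ennreal (exp (- (s * x))) * (\<integral>\<^sup>+r. ennreal (exp (s * r)) \<partial>orbit n)"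
      by (rule nn_integral_cmult) measurable
    also have "\<dots> \<le> ennreal (exp (- (s * x))) * ennreal (exp (s * B))"
      using exp_orbit_le[OF drift \<open>0 \<le> s\<close> order_refl \<open>0 \<le> B\<close>] by (rule mult_left_mono) simp
    also have "\<dots> = ennreal (exp (- (s * (x - B))))"
      by (simp add: ennreal_mult[symmetric] exp_add[symmetric] algebra_simps)
    finally show ?thesis by simp
  qed
  have "(\<lambda>n. \<integral>r. min 1 (s * c ^ n * r) \<partial>V) \<longlonglongrightarrow> (\<integral>r. 0 \<partial>V)"
  proof (rule integral_dominated_convergence[where w = "\<lambda>_. 1"])
    show "AE r in V. (\<lambda>n. min 1 (s * c ^ n * r)) \<longlonglongrightarrow> 0"
    proof (rule AE_I2)
      fix r
      have "(\<lambda>n. s * c ^ n * r) \<longlonglongrightarrow> s * 0 * r"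
        using c by (intro tendsto_intros LIMSEQ_realpow_zero) auto
      from tendsto_min[OF tendsto_const[of 1] this]
      show "(\<lambda>n. min 1 (s * c ^ n * r)) \<longlonglongrightarrow> 0" by simp
    qed
    show "AE r in V. norm (min 1 (s * c ^ n * r)) \<le> 1" for n
      using nonneg \<open>0 \<le> s\<close> c by auto
  qed auto
  then have "(\<lambda>n. exp (- (s * (x - B))) + (\<integral>r. min 1 (s * c ^ n * r) \<partial>V))
      \<longlonglongrightarrow> exp (- (s * (x - B))) + 0"
    by (intro tendsto_intros) simp
  moreover have "(\<integral>r. f r \<partial>V) \<le> exp (- (s * (x - B))) + (\<integral>r. min 1 (s * c ^ n * r) \<partial>V)" for n
    using dominated_le_orbit[OF V f_mono f_bounds f_lipschitz \<open>0 \<le> s\<close>, of n] orbit_le[of n]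
    unfolding c_def by linarith
  ultimately have "(\<integral>r. f r \<partial>V) \<le> exp (- (s * (x - B)))"
    by (intro LIMSEQ_le_const) auto
  moreover have "measure V {x<..} \<le> (\<integral>r. f r \<partial>V)"
  proof -
    have "measure V {x<..} = (\<integral>r. indicator {x<..} r \<partial>V)" by simp
    also have "\<dots> \<le> (\<integral>r. f r \<partial>V)"
    proof (rule integral_mono)
      show "integrable V f"
        using f_bounds by (intro V.integrable_const_bound[where B = 1]) auto
      show "indicator {x<..} r \<le> f r" for r
        using f_bounds[of r] \<open>0 \<le> s\<close> by (auto simp: f_def indicator_def)
    qed (simp add: V.emeasure_finite less_top[symmetric])
    finally show ?thesis .
  qed
  ultimately show ?thesis by linarith
qed

lemma drift_le:
  assumes "0 \<le> s" "0 \<le> B"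
  defines "p \<equiv> \<lambda>\<delta>. measure N {1 - \<delta>..1}"
  shows "(\<integral>m. exp (s * (q + m * B - B)) \<partial>N) \<le> p \<delta> * exp (s * q) + (1 - p \<delta>) * exp (s * (q - \<delta> * B))"
proof -
  let ?g = "\<lambda>m. exp (s * (q - \<delta> * B)) + indicator {1 - \<delta>..1} m * (exp (s * q) - exp (s * (q - \<delta> * B)))"
  have le_q: "exp (s * (q + m * B - B)) \<le> exp (s * q)" if "m \<le> 1" for m
  proof -
    have "m * B \<le> B" using mult_right_mono[OF that \<open>0 \<le> B\<close>] by simp
    then show ?thesis using \<open>0 \<le> s\<close> by (auto intro!: mult_left_mono)
  qed
  have "(\<integral>m. exp (s * (q + m * B - B)) \<partial>N) \<le> (\<integral>m. ?g m \<partial>N)"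
  proof (rule integral_mono_AE)
    show "integrable N (\<lambda>m. exp (s * (q + m * B - B)))"
    proof (rule integrable_const_bound)
      show "AE m in N. norm (exp (s * (q + m * B - B))) \<le> exp (s * q)"
        using unit_interval by eventually_elim (use le_q in auto)
    qed measurable
    show "AE m in N. exp (s * (q + m * B - B)) \<le> ?g m"
      using unit_interval
    proof eventually_elim
      case (elim m)
      show ?case
      proof (cases "1 - \<delta> \<le> m")
        case True
        then show ?thesis using le_q elim by simp
      next
        case False
        then have "m * B \<le> (1 - \<delta>) * B" using \<open>0 \<le> B\<close> by (intro mult_right_mono) auto
        then have "s * (q + m * B - B) \<le> s * (q - \<delta> * B)"
          using \<open>0 \<le> s\<close> by (intro mult_left_mono) (auto simp: algebra_simps)
        then show ?thesis using False by simp
      qed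
    qed
  qed (intro Bochner_Integration.integrable_add integrable_mult_left, auto simp: less_top[symmetric])
  also have "(\<integral>m. ?g m \<partial>N) = (\<integral>m. exp (s * (q - \<delta> * B)) \<partial>N)
      + (\<integral>m. indicator {1 - \<delta>..1} m * (exp (s * q) - exp (s * (q - \<delta> * B))) \<partial>N)"
    by (rule Bochner_Integration.integral_add) (auto intro!: integrable_mult_left simp: less_top[symmetric])
  also have "\<dots> = exp (s * (q - \<delta> * B)) + p \<delta> * (exp (s * q) - exp (s * (q - \<delta> * B)))"
    using prob_space by (simp add: p_def)
  finally show ?thesis by (simp add: algebra_simps)
qed

text \<open>By continuity from above along \<open>\<delta> \<down> 0\<close>.\<close>

lemma measure_near_one_less:
  assumes "measure N {1} < a"
  obtains \<delta> where "\<delta> > 0" "measure N {1 - \<delta>..1} < a"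
proof -
  let ?A = "\<lambda>n. {1 - inverse (real (Suc n))..1}"
  have "(\<lambda>n. measure N (?A n)) \<longlonglongrightarrow> measure N (\<Inter>n. ?A n)"
  proof (rule finite_Lim_measure_decseq)
    show "decseq ?A" by (auto simp: decseq_def field_simps intro: order_trans)
  qed auto
  moreover have "(\<Inter>n. ?A n) = {1}"
  proof -
    have "x = 1" if "\<And>n. x \<in> ?A n" for x
    proof (rule antisym)
      have "(\<lambda>n. 1 - inverse (real (Suc n))) \<longlonglongrightarrow> 1"
        using tendsto_diff[OF tendsto_const LIMSEQ_inverse_real_of_nat, of 1] by simp
      then show "1 \<le> x" by (rule LIMSEQ_le_const2) (use that in auto)
    qed (use that in auto)
    then show ?thesis by auto
  qed
  ultimately have "\<forall>\<^sub>F n in sequentially. measure N (?A n) < a"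
    using assms by (auto intro: order_tendstoD)
  then obtain n where "measure N (?A n) < a" by (auto simp: eventually_sequentially)
  then show thesis using that[of "inverse (real (Suc n))"] by simp
qed

lemma measure_near_one_mono: "\<delta> \<le> \<delta>' \<Longrightarrow> measure N {1 - \<delta>..1} \<le> measure N {1 - \<delta>'..1}"
  by (rule finite_measure_mono) auto

text \<open>The cases differ in which exponent \<open>s\<close> and comparison constant \<open>B\<close> go into
  \<open>dominated_tail_le\<close>.  The threshold comes before \<open>V\<close> because \<open>s\<close> and \<open>B\<close> are chosen from
  \<open>N\<close>, \<open>q\<close> and \<open>x\<close> alone.\<close>

theorem upper_tail:
  "\<exists>x0. \<forall>V. dominated V \<longrightarrow>
    (\<forall>x\<ge>x0. measure V {x<..} \<le> exp_mult_ln (1 / (4 * q) * x) (measure N {1 - 2 * q / x..1}))"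
proof -
  define p where "p \<delta> = measure N {1 - \<delta>..1}" for \<delta>
  have p_bounds: "0 \<le> p \<delta>" "p \<delta> \<le> 1" for \<delta> by (auto simp: p_def)
  have atom_le: "measure N {1} \<le> p \<delta>" if "0 \<le> \<delta>" for \<delta>
    using that unfolding p_def by (intro finite_measure_mono) auto
  consider (one) "measure N {1} = 1" | (atom) "0 < measure N {1}" "measure N {1} < 1"
    | (no_atom) "measure N {1} = 0"
    using measure_nonneg[of N "{1}"] prob_le_1[of "{1}"] by linarith
  then have "\<exists>x0. \<forall>V. dominated V \<longrightarrow>
    (\<forall>x\<ge>x0. measure V {x<..} \<le> exp_mult_ln (1 / (4 * q) * x) (p (2 * q / x)))"
  proof cases
    case one
    have "measure V {x<..} \<le> exp_mult_ln (1 / (4 * q) * x) (p (2 * q / x))"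
      if "dominated V" "x \<ge> 1" for V x
    proof -
      interpret V: prob_space V using that by (simp add: dominated_def)
      have "p (2 * q / x) = 1"
        using p_bounds[of "2 * q / x"] atom_le[of "2 * q / x"] one that q_pos by simp
      then show ?thesis by (simp add: exp_mult_ln_def)
    qed
    then show ?thesis by blast
  next
    case atom
    define p0 where "p0 = measure N {1}"
    have p0: "0 < p0" "p0 < 1" using atom by (auto simp: p0_def)
    \<comment> \<open>Half the critical order \<open>- ln p0 / q\<close>, twice the rate to be proved: the room left by
      the first allows some \<open>p d > p0\<close>, the room left by the second absorbs \<open>B\<close>.\<close>
    define s where "s = - ln p0 / (2 * q)"
    have s: "s > 0" using p0 q_pos by (simp add: s_def divide_neg_pos)
    have exp_sq: "exp (s * q) = 1 / sqrt p0"
      using p0 q_pos by (simp add: s_def ln_sqrt[symmetric] exp_minus field_simps)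
    have "p0 < sqrt p0" using p0 by (simp add: real_less_rsqrt power2_eq_square)
    then obtain d where d: "d > 0" "p d < sqrt p0"
      using measure_near_one_less[of "sqrt p0"] unfolding p0_def p_def by blast
    define u where "u = p d * exp (s * q)"
    have "u < 1" using d p0 by (simp add: u_def exp_sq)
    have "((\<lambda>B. u + (1 - p d) * exp (s * (q - d * B))) \<longlongrightarrow> u + (1 - p d) * 0) at_top"
      using s d by real_asymp
    then have "\<forall>\<^sub>F B in at_top. u + (1 - p d) * exp (s * (q - d * B)) < 1"
      using \<open>u < 1\<close> by (intro order_tendstoD) auto
    then have "\<forall>\<^sub>F B in at_top. u + (1 - p d) * exp (s * (q - d * B)) < 1 \<and> 0 < B"
      using eventually_gt_at_top by (rule eventually_conj)
    then obtain B where B: "u + (1 - p d) * exp (s * (q - d * B)) < 1" "0 < B"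
      by (auto dest: eventually_happens)
    have drift: "(\<integral>m. exp (s * (q + m * B - B)) \<partial>N) \<le> 1"
      using drift_le[of s B d] B s by (simp add: u_def p_def)
    have "measure V {x<..} \<le> exp_mult_ln (1 / (4 * q) * x) (p (2 * q / x))"
      if V: "dominated V" and x: "x \<ge> 2 * B" for V x
    proof -
      have "x > 0" using x B by linarith
      then have p_x: "p0 \<le> p (2 * q / x)" using atom_le q_pos by (simp add: p0_def)
      have "measure V {x<..} \<le> exp (- (s * (x - B)))"
        using dominated_tail_le[OF V atom(2) drift] s B by simp
      also have "\<dots> \<le> exp (- (s * (x / 2)))"
        using s x by simp
      also have "- (s * (x / 2)) = 1 / (4 * q) * x * ln p0"
        using q_pos by (simp add: s_def field_simps)
      also have "exp \<dots> \<le> exp (1 / (4 * q) * x * ln (p (2 * q / x)))"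
        unfolding exp_le_cancel_iff
        using p0 p_x q_pos \<open>x > 0\<close> by (intro mult_left_mono) auto
      finally show ?thesis using p0 p_x by (simp add: exp_mult_ln_def)
    qed
    then show ?thesis by blast
  next
    case no_atom
    then obtain d where d: "d > 0" "p d < 1 / 16"
      using measure_near_one_less[of "1 / 16"] unfolding p_def by auto
    have "measure V {x<..} \<le> exp_mult_ln (1 / (4 * q) * x) (p (2 * q / x))"
      if V: "dominated V" and x: "x \<ge> 2 * q / d" for V x
    proof -
      have "x > 0" using x d q_pos by (meson divide_pos_pos less_le_trans mult_pos_pos zero_less_numeral)
      define \<delta> where "\<delta> = 2 * q / x"
      have \<delta>: "0 < \<delta>" "\<delta> \<le> d" using x d \<open>x > 0\<close> q_pos by (auto simp: \<delta>_def field_simps)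
      have p\<delta>: "p \<delta> < 1 / 16"
        using measure_near_one_mono[OF \<delta>(2)] d by (simp add: p_def)
      show ?thesis
      proof (cases "p \<delta> = 0")
        case True
        have le: "measure V {x<..} \<le> exp (- (real n * (x / 2)))" for n
        proof -
          have "(\<integral>m. exp (real n * (q + m * (x / 2) - x / 2)) \<partial>N) \<le> 1"
            using drift_le[of "real n" "x / 2" \<delta>] True \<open>x > 0\<close> by (simp add: p_def \<delta>_def)
          from dominated_tail_le[OF V _ this, of x] show ?thesis
            using no_atom \<open>x > 0\<close> by simp
        qed
        have "(\<lambda>n. exp (- (real n * (x / 2)))) \<longlonglongrightarrow> 0"
          using \<open>x > 0\<close> by real_asymp
        then have "measure V {x<..} \<le> 0" by (rule LIMSEQ_le_const) (use le in auto)
        then show ?thesis using True by (simp add: exp_mult_ln_def \<delta>_def)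
      next
        case False
        then have p_pos: "0 < p \<delta>" using p_bounds[of \<delta>] by linarith
        \<comment> \<open>With \<open>w\<close> the fourth root of \<open>p \<delta>\<close>, the drift condition becomes \<open>w + (1 - p \<delta>) w \<le> 1\<close>;
          this is why \<open>p \<delta> \<le> 1 / 16\<close> is required.\<close>
        define w where "w = exp (1 / 4 * ln (p \<delta>))"
        have w: "0 < w" "w \<le> 1 / 2" "p \<delta> = w ^ 4"
        proof -
          show "0 < w" by (simp add: w_def)
          show "p \<delta> = w ^ 4" using p_pos by (simp add: w_def exp_of_nat_mult[symmetric])
          then have "w ^ 4 \<le> (1 / 2) ^ 4" using p\<delta> by (simp add: power_divide)
          then show "w \<le> 1 / 2" using power_mono_iff[of w "1 / 2" 4] \<open>0 < w\<close> by simp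
        qed
        define s where "s = - (3 / 4 * ln (p \<delta>)) / q"
        define B where "B = 2 / 3 * x"
        have sq: "s * q = - (3 * (1 / 4 * ln (p \<delta>)))" using q_pos by (simp add: s_def)
        have s: "s > 0" using p\<delta> p_pos q_pos by (auto simp: s_def intro!: divide_neg_pos)
        have "exp (s * q) = 1 / w ^ 3"
          unfolding sq w_def by (simp add: exp_minus exp_of_nat_mult[symmetric] inverse_eq_divide)
        moreover have "exp (s * (q - \<delta> * B)) = w"
        proof -
          have "s * (q - \<delta> * B) = 1 / 4 * ln (p \<delta>)"
            using q_pos \<open>x > 0\<close> by (simp add: s_def \<delta>_def B_def field_simps)
          then show ?thesis by (simp only: w_def)
        qed
        ultimately have "p \<delta> * exp (s * q) + (1 - p \<delta>) * exp (s * (q - \<delta> * B)) = w + (1 - p \<delta>) * w"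
          using w by (simp add: power4_eq_xxxx power3_eq_cube)
        also have "\<dots> \<le> w + 1 * w" using w p_pos by (intro add_left_mono mult_right_mono) auto
        also have "\<dots> \<le> 1" using w by simp
        finally have drift: "(\<integral>m. exp (s * (q + m * B - B)) \<partial>N) \<le> 1"
          using drift_le[of s B \<delta>] s \<open>x > 0\<close> by (simp add: p_def B_def)
        have "measure V {x<..} \<le> exp (- (s * (x - B)))"
          using dominated_tail_le[OF V _ drift, of x] no_atom s \<open>x > 0\<close> by (simp add: B_def)
        also have "- (s * (x - B)) = 1 / (4 * q) * x * ln (p \<delta>)"
          using q_pos by (simp add: s_def B_def field_simps)
        finally show ?thesis using False by (simp add: exp_mult_ln_def \<delta>_def)
      qed
    qed
    then show ?thesis by blast
  qed
  then show ?thesis by (simp add: p_def)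
qed

end
section \<open>From perpetuities to the majorising recursion\<close>

lemma perpetuity_indep_var:
  assumes "perpetuity P M Q R"
  shows "prob_space.indep_var P borel M borel R"
proof -
  interpret prob_space P using assms by (simp add: perpetuity_def)
  have [measurable]: "M \<in> borel_measurable P" "R \<in> borel_measurable P"
    using assms by (auto simp: perpetuity_def)
  have indep: "indep_set {(\<lambda>\<omega>. (M \<omega>, Q \<omega>)) -` A \<inter> space P |A. A \<in> sets borel}
      {R -` B \<inter> space P |B. B \<in> sets borel}"
    using assms by (simp add: perpetuity_def indep_rv_def)
  have "indep_set {M -` A \<inter> space P |A. A \<in> sets borel} {R -` B \<inter> space P |B. B \<in> sets borel}"
  proof (rule indep_setI)
    fix a b
    assume "a \<in> {M -` A \<inter> space P |A. A \<in> sets borel}"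
      and b: "b \<in> {R -` B \<inter> space P |B. B \<in> sets borel}"
    then obtain A where A: "A \<in> sets borel" "a = M -` A \<inter> space P" by blast
    have "A \<times> (UNIV :: real set) \<in> sets borel"
      using A(1) unfolding borel_prod[symmetric] by simp
    moreover have "a = (\<lambda>\<omega>. (M \<omega>, Q \<omega>)) -` (A \<times> UNIV) \<inter> space P" using A(2) by auto
    ultimately show "prob (a \<inter> b) = prob a * prob b" by (intro indep_setD[OF indep] b) blast
  qed auto
  moreover have "Int_stable {X -` A \<inter> space P |A. A \<in> sets borel}" for X :: "'a \<Rightarrow> real"
  proof (rule Int_stableI, safe)
    fix A B :: "real set" assume "A \<in> sets borel" "B \<in> sets borel"
    then show "\<exists>C. X -` A \<inter> space P \<inter> (X -` B \<inter> space P) = X -` C \<inter> space P \<and> C \<in> sets borel"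
      by (intro exI[of _ "A \<inter> B"]) auto
  qed
  ultimately have "indep_set (sigma_sets (space P) {M -` A \<inter> space P |A. A \<in> sets borel})
      (sigma_sets (space P) {R -` B \<inter> space P |B. B \<in> sets borel})"
    by (intro indep_set_sigma_sets)
  then show ?thesis by (simp add: indep_var_eq)
qed

lemma perpetuity_prob_eq:
  assumes "perpetuity P M Q R" and "A \<in> sets borel"
  shows "\<P>(\<omega> in P. R \<omega> \<in> A) = \<P>(\<omega> in P. M \<omega> * R \<omega> + Q \<omega> \<in> A)"
proof -
  have [measurable]: "M \<in> borel_measurable P" "Q \<in> borel_measurable P" "R \<in> borel_measurable P"
    using assms by (auto simp: perpetuity_def)
  have "measure (distr P borel R) A = measure (distr P borel (\<lambda>\<omega>. M \<omega> * R \<omega> + Q \<omega>)) A"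
    using assms by (simp add: perpetuity_def eq_distr_def)
  then show ?thesis using assms(2) by (simp add: measure_distr vimage_def Int_def conj_commute)
qed

lemma perpetuity_dominated:
  assumes perp: "perpetuity P M Q R"
    and Q: "AE \<omega> in P. \<bar>Q \<omega>\<bar> \<le> q" and M: "AE \<omega> in P. \<bar>M \<omega>\<bar> \<le> 1" and "q > 0"
  shows "contraction_law (distr P borel (\<lambda>\<omega>. \<bar>M \<omega>\<bar>)) q"
    and "contraction_law.dominated (distr P borel (\<lambda>\<omega>. \<bar>M \<omega>\<bar>)) q (distr P borel (\<lambda>\<omega>. \<bar>R \<omega>\<bar>))"
proof -
  interpret prob_space P using perp by (simp add: perpetuity_def)
  have [measurable]: "M \<in> borel_measurable P" "Q \<in> borel_measurable P" "R \<in> borel_measurable P"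
    using perp by (auto simp: perpetuity_def)
  let ?N = "distr P borel (\<lambda>\<omega>. \<bar>M \<omega>\<bar>)" and ?V = "distr P borel (\<lambda>\<omega>. \<bar>R \<omega>\<bar>)"
  interpret N: contraction_law ?N q
  proof (rule contraction_law.intro)
    show "prob_space ?N" by (rule prob_space_distr) measurable
    show "contraction_law_axioms ?N q"
      using M \<open>q > 0\<close> by unfold_locales (simp_all add: AE_distr_iff)
  qed
  show "contraction_law ?N q" by unfold_locales
  have "indep_var borel (abs \<circ> M) borel (abs \<circ> R)"
    by (rule indep_var_compose[OF perpetuity_indep_var[OF perp]]) auto
  then have "?N \<Otimes>\<^sub>M ?V = distr P (borel \<Otimes>\<^sub>M borel) (\<lambda>\<omega>. (\<bar>M \<omega>\<bar>, \<bar>R \<omega>\<bar>))"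
    by (simp add: indep_var_distribution_eq comp_def)
  then have step_eq: "N.step ?V = distr P borel (\<lambda>\<omega>. \<bar>M \<omega>\<bar> * \<bar>R \<omega>\<bar> + q)"
    by (simp add: N.step_def distr_distr comp_def)
  have "(\<integral>r. f r \<partial>?V) \<le> (\<integral>r. f r \<partial>N.step ?V)"
    if f: "mono f" "\<And>r. 0 \<le> f r \<and> f r \<le> 1" for f :: "real \<Rightarrow> real"
  proof -
    have [measurable]: "f \<in> borel_measurable borel" using f(1) by (rule borel_measurable_mono)
    have "(\<integral>r. f r \<partial>?V) = (\<integral>r. f \<bar>r\<bar> \<partial>distr P borel R)"
      by (simp add: integral_distr)
    also have "\<dots> = (\<integral>r. f \<bar>r\<bar> \<partial>distr P borel (\<lambda>\<omega>. M \<omega> * R \<omega> + Q \<omega>))"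
      using perp by (simp add: perpetuity_def eq_distr_def)
    also have "\<dots> = (\<integral>\<omega>. f \<bar>M \<omega> * R \<omega> + Q \<omega>\<bar> \<partial>P)"
      by (simp add: integral_distr)
    also have "\<dots> \<le> (\<integral>\<omega>. f (\<bar>M \<omega>\<bar> * \<bar>R \<omega>\<bar> + q) \<partial>P)"
    proof (rule integral_mono_AE)
      show "AE \<omega> in P. f \<bar>M \<omega> * R \<omega> + Q \<omega>\<bar> \<le> f (\<bar>M \<omega>\<bar> * \<bar>R \<omega>\<bar> + q)"
        using Q
      proof eventually_elim
        case (elim \<omega>)
        have "\<bar>M \<omega> * R \<omega> + Q \<omega>\<bar> \<le> \<bar>M \<omega>\<bar> * \<bar>R \<omega>\<bar> + q"
          using abs_triangle_ineq[of "M \<omega> * R \<omega>" "Q \<omega>"] elim by (simp add: abs_mult)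
        then show ?case by (rule monoD[OF f(1)])
      qed
    qed (use f(2) in \<open>auto intro!: integrable_const_bound[where B = 1]\<close>)
    also have "\<dots> = (\<integral>r. f r \<partial>N.step ?V)"
      by (simp add: step_eq integral_distr)
    finally show ?thesis .
  qed
  moreover have "prob_space ?V" by (rule prob_space_distr) measurable
  ultimately show "N.dominated ?V"
    by (auto simp: N.dominated_def AE_distr_iff)
qed

section \<open>The lower bound\<close>

text \<open>If \<open>MR + q < t\<close> with \<open>t \<le> q\<close>, then \<open>R\<close> is negative, so \<open>R \<le> MR < t - q\<close>.  Hence the distribution
  function of \<open>R\<close> does not decrease when \<open>t\<close> is lowered by \<open>q\<close>, and since it tends to \<open>0\<close> at
  \<open>-\<infinity>\<close> it vanishes at \<open>q\<close>.\<close>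

lemma perpetuity_ge:
  assumes perp: "perpetuity P M Q R"
    and Q: "AE \<omega> in P. Q \<omega> = q" and M: "AE \<omega> in P. 0 \<le> M \<omega> \<and> M \<omega> \<le> 1" and "q > 0"
  shows "AE \<omega> in P. q \<le> R \<omega>"
proof -
  interpret prob_space P using perp by (simp add: perpetuity_def)
  have [measurable]: "M \<in> borel_measurable P" "Q \<in> borel_measurable P" "R \<in> borel_measurable P"
    using perp by (auto simp: perpetuity_def)
  have shift: "\<P>(\<omega> in P. R \<omega> < t) \<le> \<P>(\<omega> in P. R \<omega> < t - q)" if "t \<le> q" for t
  proof -
    have "\<P>(\<omega> in P. R \<omega> < t) = \<P>(\<omega> in P. M \<omega> * R \<omega> + Q \<omega> < t)"
      using perpetuity_prob_eq[OF perp, of "{..<t}"] by simp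
    also have "\<dots> \<le> \<P>(\<omega> in P. R \<omega> < t - q)"
    proof (rule finite_measure_mono_AE)
      show "AE \<omega> in P. \<omega> \<in> {\<omega> \<in> space P. M \<omega> * R \<omega> + Q \<omega> < t} \<longrightarrow> \<omega> \<in> {\<omega> \<in> space P. R \<omega> < t - q}"
        using M Q
      proof eventually_elim
        case (elim \<omega>)
        have "R \<omega> < t - q" if "M \<omega> * R \<omega> + Q \<omega> < t"
        proof -
          have neg: "M \<omega> * R \<omega> < t - q" using that elim by simp
          then have "M \<omega> * R \<omega> < 0" using \<open>t \<le> q\<close> by simp
          then have "R \<omega> \<le> 0" using elim by (metis mult_nonneg_nonneg linorder_not_le less_imp_le)
          then have "R \<omega> \<le> M \<omega> * R \<omega>" using elim by (simp add: mult_le_cancel_right1)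
          with neg show ?thesis by simp
        qed
        then show ?case by auto
      qed
    qed measurable
    finally show ?thesis .
  qed
  have iterate: "\<P>(\<omega> in P. R \<omega> < q) \<le> \<P>(\<omega> in P. R \<omega> < q - real n * q)" for n
  proof (induction n)
    case (Suc n)
    have "q - real n * q \<le> q" using \<open>q > 0\<close> by simp
    from order_trans[OF Suc shift[OF this]] show ?case by (simp add: algebra_simps)
  qed simp
  let ?A = "\<lambda>n. {\<omega> \<in> space P. R \<omega> < q - real n * q}"
  have "(\<lambda>n. prob (?A n)) \<longlonglongrightarrow> prob (\<Inter>n. ?A n)"
  proof (rule finite_Lim_measure_decseq)
    show "decseq ?A"
    proof (rule decseq_SucI)
      show "?A (Suc n) \<subseteq> ?A n" for n using \<open>q > 0\<close> by (auto simp: algebra_simps)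
    qed
  qed auto
  moreover have "(\<Inter>n. ?A n) = {}"
  proof -
    have "\<exists>n. \<not> R \<omega> < q - real n * q" for \<omega>
    proof -
      obtain n where "(q - R \<omega>) / q \<le> real n" using real_arch_simple by blast
      then show ?thesis using \<open>q > 0\<close> by (intro exI[of _ n]) (simp add: field_simps)
    qed
    then show ?thesis by blast
  qed
  ultimately have "(\<lambda>n. prob (?A n)) \<longlonglongrightarrow> 0" by simp
  then have "\<P>(\<omega> in P. R \<omega> < q) \<le> 0"
    by (rule LIMSEQ_le_const) (use iterate in auto)
  then have "\<P>(\<omega> in P. R \<omega> < q) = 0" using measure_nonneg[of P] by (intro antisym) auto
  then have "AE \<omega> in P. \<not> R \<omega> < q" by (subst (asm) prob_Collect_eq_0) auto
  then show ?thesis by (simp add: not_less)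
qed

text \<open>If \<open>M \<ge> 1 - \<delta>\<close> and, independently, \<open>R\<close> is at least the partial sum for \<open>n\<close>, then \<open>MR + q\<close>, which
  has the law of \<open>R\<close>, is at least the partial sum for \<open>Suc n\<close>.\<close>

lemma perpetuity_geometric_lower:
  assumes perp: "perpetuity P M Q R"
    and Q: "AE \<omega> in P. Q \<omega> = q" and M: "AE \<omega> in P. 0 \<le> M \<omega> \<and> M \<omega> \<le> 1" and "q > 0"
    and \<delta>: "0 \<le> \<delta>" "\<delta> \<le> 1"
  shows "p_near_one P M \<delta> ^ n \<le> \<P>(\<omega> in P. R \<omega> \<ge> q * (\<Sum>k\<le>n. (1 - \<delta>) ^ k))"
proof (induction n)
  interpret prob_space P using perp by (simp add: perpetuity_def)
  {
    case 0
    show ?case using perpetuity_ge[OF perp Q M \<open>q > 0\<close>] perp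
      by (subst prob_Collect_eq_1[THEN iffD2]) (auto simp: perpetuity_def)
  next
    case (Suc n)
    have [measurable]: "M \<in> borel_measurable P" "Q \<in> borel_measurable P" "R \<in> borel_measurable P"
      using perp by (auto simp: perpetuity_def)
    define S where "S n = q * (\<Sum>k\<le>n. (1 - \<delta>) ^ k)" for n
    have S_Suc: "S (Suc n) = (1 - \<delta>) * S n + q"
      by (simp add: S_def sum.atMost_Suc_shift sum_distrib_left algebra_simps del: sum.atMost_Suc)
    have S_nonneg: "0 \<le> S n" using \<open>q > 0\<close> \<delta> by (auto simp: S_def intro!: mult_nonneg_nonneg sum_nonneg)
    have "p_near_one P M \<delta> ^ Suc n \<le> p_near_one P M \<delta> * \<P>(\<omega> in P. R \<omega> \<ge> S n)"
      using Suc by (simp add: S_def mult_left_mono p_near_one_def)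
    also have "\<dots> = \<P>(\<omega> in P. M \<omega> \<in> {m. 1 - \<delta> \<le> \<bar>m\<bar> \<and> \<bar>m\<bar> \<le> 1}) * \<P>(\<omega> in P. R \<omega> \<in> {S n..})"
      by (simp add: p_near_one_def)
    also have "\<dots> = \<P>(\<omega> in P. M \<omega> \<in> {m. 1 - \<delta> \<le> \<bar>m\<bar> \<and> \<bar>m\<bar> \<le> 1} \<and> R \<omega> \<in> {S n..})"
      using indep_varD[OF perpetuity_indep_var[OF perp], of "{m. 1 - \<delta> \<le> \<bar>m\<bar> \<and> \<bar>m\<bar> \<le> 1}" "{S n..}"]
      by (simp add: vimage_def Int_def conj_commute conj_left_commute)
    also have "\<dots> \<le> \<P>(\<omega> in P. M \<omega> * R \<omega> + Q \<omega> \<in> {S (Suc n)..})"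
    proof (rule finite_measure_mono_AE)
      show "AE \<omega> in P. \<omega> \<in> {\<omega> \<in> space P. M \<omega> \<in> {m. 1 - \<delta> \<le> \<bar>m\<bar> \<and> \<bar>m\<bar> \<le> 1} \<and> R \<omega> \<in> {S n..}}
          \<longrightarrow> \<omega> \<in> {\<omega> \<in> space P. M \<omega> * R \<omega> + Q \<omega> \<in> {S (Suc n)..}}"
        using M Q
      proof eventually_elim
        case (elim \<omega>)
        have "(1 - \<delta>) * S n \<le> M \<omega> * R \<omega>" if "1 - \<delta> \<le> \<bar>M \<omega>\<bar>" "S n \<le> R \<omega>"
          using that elim S_nonneg by (intro mult_mono) auto
        then show ?case using elim by (auto simp: S_Suc)
      qed
    qed measurable
    also have "\<dots> = \<P>(\<omega> in P. R \<omega> \<ge> S (Suc n))"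
      using perpetuity_prob_eq[OF perp, of "{S (Suc n)..}"] by simp
    finally show ?case by (simp add: S_def)
  }
qed

lemma perpetuity_lower_tail:
  assumes perp: "perpetuity P M Q R"
    and Q: "AE \<omega> in P. Q \<omega> = q" and M: "AE \<omega> in P. 0 \<le> M \<omega> \<and> M \<omega> \<le> 1" and "q > 0"
    and "x \<ge> q"
  shows "exp_mult_ln (2 * ln 2 / q * x) (p_near_one P M (q / (2 * x))) \<le> \<P>(\<omega> in P. R \<omega> > x)"
proof -
  interpret prob_space P using perp by (simp add: perpetuity_def)
  have [measurable]: "R \<in> borel_measurable P" using perp by (simp add: perpetuity_def)
  define \<delta> where "\<delta> = q / (2 * x)"
  have \<delta>: "0 < \<delta>" "\<delta> < 1" and x: "x = q / (2 * \<delta>)"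
    using assms(4,5) by (auto simp: \<delta>_def field_simps)
  define p where "p = p_near_one P M \<delta>"
  have p: "0 \<le> p" "p \<le> 1" by (auto simp: p_def p_near_one_def)
  \<comment> \<open>Rounding down is harmless because the partial sum has \<open>n + 1\<close> terms, and
    \<open>(1 - \<delta>) ^ (n + 1) < 1 / 2\<close> only needs \<open>n + 1 > ln 2 / \<delta>\<close>.\<close>
  define n where "n = nat \<lfloor>ln 2 / \<delta>\<rfloor>"
  have n: "real n \<le> ln 2 / \<delta>" "ln 2 / \<delta> < real n + 1"
    using \<delta> by (auto simp: n_def)
  have "(1 - \<delta>) ^ Suc n \<le> exp (- \<delta>) ^ Suc n"
    using \<delta> exp_ge_add_one_self[of "- \<delta>"] by (intro power_mono) auto
  also have "\<dots> = exp (real (Suc n) * - \<delta>)" by (rule exp_of_nat_mult[symmetric])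
  also have "real (Suc n) * - \<delta> = - (\<delta> * (real n + 1))" by (simp add: algebra_simps)
  also have "exp \<dots> < exp (- ln 2)" using n \<delta> by (simp add: field_simps)
  also have "\<dots> = 1 / 2" by (simp add: exp_minus)
  finally have "1 / 2 < \<delta> * (\<Sum>k\<le>n. (1 - \<delta>) ^ k)"
    using sum_gp_basic[of "1 - \<delta>" n] by simp
  then have x_less: "x < q * (\<Sum>k\<le>n. (1 - \<delta>) ^ k)"
    using \<delta> \<open>q > 0\<close> by (simp add: x field_simps)
  have "exp_mult_ln (ln 2 / \<delta>) p \<le> p ^ n"
  proof (cases "p = 0")
    case False
    then have "exp (ln 2 / \<delta> * ln p) \<le> exp (real n * ln p)"
      unfolding exp_le_cancel_iff using p n by (intro mult_right_mono_neg) auto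
    also have "\<dots> = p ^ n" using False p by (simp add: exp_of_nat_mult)
    finally show ?thesis using False by (simp add: exp_mult_ln_def)
  qed (simp add: exp_mult_ln_def)
  also have "\<dots> \<le> \<P>(\<omega> in P. R \<omega> \<ge> q * (\<Sum>k\<le>n. (1 - \<delta>) ^ k))"
    unfolding p_def using perpetuity_geometric_lower[OF perp Q M \<open>q > 0\<close>] \<delta> by simp
  also have "\<dots> \<le> \<P>(\<omega> in P. R \<omega> > x)"
    using x_less by (intro finite_measure_mono) auto
  also have "ln 2 / \<delta> = 2 * ln 2 / q * x" by (simp add: \<delta>_def)
  finally show ?thesis by (simp add: p_def \<delta>_def)
qed

section \<open>Tails of perpetuities\<close>

theorem proposition1:
  fixes q :: real and \<mu> :: "(real \<times> real) measure"
  assumes "q > 0"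
  shows "\<exists>x0. \<forall>(P :: 'a measure) M Q R.
    perpetuity P M Q R \<and> distr P borel (\<lambda>\<omega>. (M \<omega>, Q \<omega>)) = \<mu> \<and>
    (AE \<omega> in P. \<bar>Q \<omega>\<bar> \<le> q) \<and> (AE \<omega> in P. \<bar>M \<omega>\<bar> \<le> 1) \<longrightarrow>
    (\<forall>x\<ge>x0. \<P>(\<omega> in P. \<bar>R \<omega>\<bar> > x)
        \<le> exp_mult_ln (1 / (4 * q) * x) (p_near_one P M (2 * q / x))) \<and>
    ((AE \<omega> in P. Q \<omega> = q) \<and> (AE \<omega> in P. 0 \<le> M \<omega> \<and> M \<omega> \<le> 1) \<longrightarrow>
      (\<forall>x\<ge>x0.
        exp_mult_ln (2 * ln 2 / q * x) (p_near_one P M (q / (2 * x)))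
          \<le> \<P>(\<omega> in P. R \<omega> > x) \<and>
        \<P>(\<omega> in P. R \<omega> > x)
          \<le> exp_mult_ln (1 / (4 * q) * x) (p_near_one P M (2 * q / x))))"
proof -
  define N where "N = distr \<mu> borel (\<lambda>z. \<bar>fst z\<bar>)"
  have N_eq: "N = distr P borel (\<lambda>\<omega>. \<bar>M \<omega>\<bar>)"
    if "perpetuity P M Q R" "distr P borel (\<lambda>\<omega>. (M \<omega>, Q \<omega>)) = \<mu>" for P :: "'a measure" and M Q R
  proof -
    have [measurable]: "M \<in> borel_measurable P" "Q \<in> borel_measurable P"
      using that by (auto simp: perpetuity_def)
    show ?thesis unfolding N_def that(2)[symmetric]
      by (subst distr_distr) (auto simp: comp_def borel_prod[symmetric])
  qed
  obtain x0 where x0: "\<And>V x. \<lbrakk>contraction_law N q; contraction_law.dominated N q V; x \<ge> x0\<rbrakk>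
      \<Longrightarrow> measure V {x<..} \<le> exp_mult_ln (1 / (4 * q) * x) (measure N {1 - 2 * q / x..1})"
    using contraction_law.upper_tail[of N q] by blast
  show ?thesis
  proof (intro exI[of _ "max x0 q"] allI impI, elim conjE)
    fix P :: "'a measure" and M Q R
    assume perp: "perpetuity P M Q R" and law: "distr P borel (\<lambda>\<omega>. (M \<omega>, Q \<omega>)) = \<mu>"
      and Q: "AE \<omega> in P. \<bar>Q \<omega>\<bar> \<le> q" and M: "AE \<omega> in P. \<bar>M \<omega>\<bar> \<le> 1"
    interpret prob_space P using perp by (simp add: perpetuity_def)
    have [measurable]: "M \<in> borel_measurable P" "R \<in> borel_measurable P"
      using perp by (auto simp: perpetuity_def)
    have upper: "\<P>(\<omega> in P. \<bar>R \<omega>\<bar> > x) \<le> exp_mult_ln (1 / (4 * q) * x) (p_near_one P M (2 * q / x))"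
      if "x \<ge> x0" for x
    proof -
      have "measure (distr P borel (\<lambda>\<omega>. \<bar>R \<omega>\<bar>)) {x<..} = \<P>(\<omega> in P. \<bar>R \<omega>\<bar> > x)"
        by (simp add: measure_distr vimage_def Int_def conj_commute)
      moreover have "measure N {1 - 2 * q / x..1} = p_near_one P M (2 * q / x)"
        by (simp add: N_eq[OF perp law] p_near_one_def measure_distr vimage_def Int_def conj_commute)
      ultimately show ?thesis
        using x0[of "distr P borel (\<lambda>\<omega>. \<bar>R \<omega>\<bar>)" x] that perpetuity_dominated[OF perp Q M assms]
        by (simp add: N_eq[OF perp law])
    qed
    have "\<P>(\<omega> in P. R \<omega> > x) \<le> \<P>(\<omega> in P. \<bar>R \<omega>\<bar> > x)" for x
      by (rule finite_measure_mono) auto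
    then have "\<P>(\<omega> in P. R \<omega> > x) \<le> exp_mult_ln (1 / (4 * q) * x) (p_near_one P M (2 * q / x))"
      if "x \<ge> x0" for x
      using upper[OF that] order_trans by blast
    then show "(\<forall>x\<ge>max x0 q. \<P>(\<omega> in P. \<bar>R \<omega>\<bar> > x)
        \<le> exp_mult_ln (1 / (4 * q) * x) (p_near_one P M (2 * q / x))) \<and>
      ((AE \<omega> in P. Q \<omega> = q) \<and> (AE \<omega> in P. 0 \<le> M \<omega> \<and> M \<omega> \<le> 1) \<longrightarrow>
      (\<forall>x\<ge>max x0 q.
        exp_mult_ln (2 * ln 2 / q * x) (p_near_one P M (q / (2 * x)))
          \<le> \<P>(\<omega> in P. R \<omega> > x) \<and>
        \<P>(\<omega> in P. R \<omega> > x)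
          \<le> exp_mult_ln (1 / (4 * q) * x) (p_near_one P M (2 * q / x))))"
      using upper perpetuity_lower_tail[OF perp _ _ assms] by auto
  qed
qed

end
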